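(* When using $T$ iterations of SGD, $w_{k+1}=w_k-\gamma_k\alpha_k\nabla f_{i_k}(w_k)$, to minimize the sum $f(w)=\frac{f_1(w)+f_2(w)}{2}$ of two one-dimensional quadratics, $f_1(w)=\frac12(w-1)^2$ and $f_2(w)=\frac12\left(2w+\frac12\right)^2$, setting $\gamma_k$ using the stochastic line-search (SLS) with $\gamma_{\max}\ge 1$ and $c\ge\frac12$, any convergent sequence of $\alpha_k$ results in convergence to a neighbourhood of the solution. Specifically, if $w^*$ is the minimizer of $f$ and $w_1>0$, then $$\mathbb{E}(w_T-w^* )\ge\min\left(w_1,\frac38\right).$$
   Context: In each iteration $k$, SGD selects an index $i_k\in\{1,2\}$ uniformly at random and uses the gradient of $f_{i_k}$ at the current iterate $w_k$; $w_1$ is the starting point and $\mathbb{E}$ is expectation over the random indices. The step-size is the product $\gamma_k\alpha_k$, where $\alpha_k$ is a problem-independent term that controls the decay of the step-size and $\gamma_k$ is a problem-dependent scaling term. The stochastic line-search with parameters $\gamma_{\max}$ and $c\in(0,1)$ sets $\gamma_k$ at iteration $k$ to be the largest step-size satisfying $\gamma_k\le\gamma_{\max}$ and $f_{i_k}(w_k-\gamma_k\nabla f_{i_k}(w_k))\le f_{i_k}(w_k)-c\,\gamma_k\|\nabla f_{i_k}(w_k)\|^2$.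
   Formalization: The decay factors are assumed to satisfy 0 ≤ α_k ≤ 1; for an arbitrary convergent sequence the bound fails, e.g. c = 1/2, α_k = 2, w_1 = 1 gives E(w_2 − w* ) = −1/4 < 3/8. *)

theory Defs
  imports "HOL-Probability.Probability"
begin

definition f1 :: "real \<Rightarrow> real" where
  "f1 w = 1/2 * (w - 1)\<^sup>2"

definition f2 :: "real \<Rightarrow> real" where
  "f2 w = 1/2 * (2 * w + 1/2)\<^sup>2"

definition component :: "nat \<Rightarrow> real \<Rightarrow> real" where
  "component j = (if j = 1 then f1 else f2)"

definition objective :: "real \<Rightarrow> real" where
  "objective w = (f1 w + f2 w) / 2"

text \<open>Step-sizes admissible at the point \<open>w\<close>: the upper bound \<open>gmax\<close> together with the Armijo
  condition for the sampled function \<open>g\<close>. Positivity is not demanded: \<open>0\<close> is always admissible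
  when \<open>0 \<le> gmax\<close>, so a largest admissible step-size is never negative.\<close>

definition sls_admissible :: "(real \<Rightarrow> real) \<Rightarrow> real \<Rightarrow> real \<Rightarrow> real \<Rightarrow> real \<Rightarrow> bool" where
  "sls_admissible g gmax c w \<gamma> \<longleftrightarrow>
     \<gamma> \<le> gmax \<and> g (w - \<gamma> * deriv g w) \<le> g w - c * \<gamma> * (norm (deriv g w))\<^sup>2"

definition sls_step :: "(real \<Rightarrow> real) \<Rightarrow> real \<Rightarrow> real \<Rightarrow> real \<Rightarrow> real \<Rightarrow> bool" where
  "sls_step g gmax c w \<gamma> \<longleftrightarrow>
     sls_admissible g gmax c w \<gamma> \<and> (\<forall>\<gamma>'. sls_admissible g gmax c w \<gamma>' \<longrightarrow> \<gamma>' \<le> \<gamma>)"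

text \<open>A \<open>T\<close>-iteration run of SGD with line-search on a probability space \<open>M\<close>; iterations are numbered
  from \<open>1\<close>. The sampled indices \<open>i k\<close> are independent and uniform on \<open>{1, 2}\<close>, and the scalings
  \<open>\<gamma> k\<close> and iterates \<open>w k\<close> are random because they depend on the sampled indices.\<close>

definition sgd_sls_run ::
  "'a measure \<Rightarrow> nat \<Rightarrow> real \<Rightarrow> real \<Rightarrow> (nat \<Rightarrow> real) \<Rightarrow> real \<Rightarrow>
   (nat \<Rightarrow> 'a \<Rightarrow> nat) \<Rightarrow> (nat \<Rightarrow> 'a \<Rightarrow> real) \<Rightarrow> (nat \<Rightarrow> 'a \<Rightarrow> real) \<Rightarrow> bool" where
  "sgd_sls_run M T gmax c \<alpha> w1 i \<gamma> w \<longleftrightarrow>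
     prob_space M \<and>
     prob_space.indep_vars M (\<lambda>_. count_space {1, 2}) i {1..T} \<and>
     (\<forall>k\<in>{1..T}. distr M (count_space {1, 2}) (i k) = uniform_count_measure {1, 2}) \<and>
     (\<forall>\<omega>\<in>space M. w 1 \<omega> = w1) \<and>
     (\<forall>k\<in>{1..T}. \<forall>\<omega>\<in>space M.
        sls_step (component (i k \<omega>)) gmax c (w k \<omega>) (\<gamma> k \<omega>) \<and>
        w (k + 1) \<omega> = w k \<omega> - \<gamma> k \<omega> * \<alpha> k * deriv (component (i k \<omega>)) (w k \<omega>))"

end

theory Submission
  imports Defs
begin

text \<open>Both components have the form \<open>L/2 * (x - m)\<^sup>2\<close>, with curvature \<open>L = 1\<close> and minimizer
  \<open>m = 1\<close> for \<^const>\<open>f1\<close>, and \<open>L = 4\<close>, \<open>m = -1/4\<close> for \<^const>\<open>f2\<close>. Away from the minimizer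
  of such a function, the largest step-size satisfying the Armijo condition is \<open>2 * (1 - c) / L\<close>,
  which is at most \<open>1\<close> for \<open>1/2 \<le> c\<close> and hence not cut off by \<open>gmax \<ge> 1\<close>. The
  curvature cancels against the gradient \<open>L * (x - m)\<close>, so iteration \<open>k\<close> covers the same fraction
  \<open>a = 2 * (1 - c) * \<alpha> k\<close> of the way to the sampled minimizer, whichever component is drawn
  (lemma \<open>sls_update_quadratic\<close>).

  The iteration is therefore \<open>w' = (1 - a) * w + a * m\<close>, with \<open>m\<close> the random minimizer. It is affine
  with a deterministic coefficient, so linearity gives the mean the recursion with \<open>m\<close> replaced by
  its average \<open>(1 - 1/4) / 2 = 3/8\<close> (lemma \<open>sgd_sls_run_mean\<close>). As
  \<open>0 \<le> a \<le> 1\<close>, the mean moves by convex combinations towards \<open>3/8\<close> and never falls below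
  \<open>min w1 (3/8)\<close>. The objective is minimized at \<open>0\<close> instead, the average of \<open>1\<close> and \<open>-1/4\<close> weighted
  by the curvatures \<open>1\<close> and \<open>4\<close>; the bias arises because the line-search normalizes these weights
  away.\<close>

lemma deriv_quadratic:
  fixes L m w :: real
  shows "deriv (\<lambda>x. L / 2 * (x - m)\<^sup>2) w = L * (w - m)"
  by (rule DERIV_imp_deriv) (auto intro!: derivative_eq_intros)

text \<open>With \<open>d = x - m\<close>, a step of size \<open>g\<close> leaves the displacement \<open>(1 - L * g) * d\<close>, so after
  division by \<open>L/2 * d\<^sup>2\<close> the Armijo condition reads \<open>(1 - L * g)\<^sup>2 \<le> 1 - 2 * c * L * g\<close>, which
  factors as below.\<close>

lemma sls_admissible_quadratic_iff:
  fixes L m x :: real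
  assumes "0 < L" and "x \<noteq> m"
  shows "sls_admissible (\<lambda>x. L / 2 * (x - m)\<^sup>2) gmax c x g
    \<longleftrightarrow> g \<le> gmax \<and> g * (L * g - 2 * (1 - c)) \<le> 0"
proof -
  have "0 < L\<^sup>2 / 2 * (x - m)\<^sup>2"
    using assms by simp
  moreover have "L / 2 * (x - g * (L * (x - m)) - m)\<^sup>2
      - (L / 2 * (x - m)\<^sup>2 - c * g * (norm (L * (x - m)))\<^sup>2)
    = (L\<^sup>2 / 2 * (x - m)\<^sup>2) * (g * (L * g - 2 * (1 - c)))"
    by (simp add: power_mult_distrib abs_mult) (simp add: power2_eq_square field_simps)
  ultimately have "L / 2 * (x - g * (L * (x - m)) - m)\<^sup>2
      \<le> L / 2 * (x - m)\<^sup>2 - c * g * (norm (L * (x - m)))\<^sup>2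
    \<longleftrightarrow> g * (L * g - 2 * (1 - c)) \<le> 0"
    by (smt (verit) mult_le_0_iff)
  then show ?thesis
    unfolding sls_admissible_def deriv_quadratic by blast
qed

lemma sls_step_quadratic:
  fixes L m x :: real
  assumes "0 < L" and "x \<noteq> m" and "c \<le> 1" and "2 * (1 - c) / L \<le> gmax"
    and step: "sls_step (\<lambda>x. L / 2 * (x - m)\<^sup>2) gmax c x g"
  shows "g = 2 * (1 - c) / L"
proof (rule antisym)
  note iff = sls_admissible_quadratic_iff[OF \<open>0 < L\<close> \<open>x \<noteq> m\<close>]
  have "sls_admissible (\<lambda>x. L / 2 * (x - m)\<^sup>2) gmax c x (2 * (1 - c) / L)"
    unfolding iff using assms(1,4) by simp
  then show ge: "2 * (1 - c) / L \<le> g"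
    using step by (simp add: sls_step_def)
  have "0 \<le> 2 * (1 - c) / L"
    using assms(1,3) by simp
  then have "0 \<le> g"
    using ge by simp
  have "g * (L * g - 2 * (1 - c)) \<le> 0"
    using step unfolding sls_step_def iff by blast
  then have "g = 0 \<or> L * g \<le> 2 * (1 - c)"
    using \<open>0 \<le> g\<close> by (auto simp: mult_le_0_iff)
  then show "g \<le> 2 * (1 - c) / L"
    using \<open>0 < L\<close> \<open>0 \<le> 2 * (1 - c) / L\<close> by (auto simp: field_simps)
qed

text \<open>The curvature \<open>L\<close> disappears from the update. At \<open>x = m\<close> every step-size up to \<open>gmax\<close> is
  admissible, but the gradient vanishes there, so the formula covers that point as well.\<close>

lemma sls_update_quadratic:
  fixes L m x :: real
  assumes "0 < L" and "c \<le> 1" and "2 * (1 - c) / L \<le> gmax"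
    and "sls_step (\<lambda>x. L / 2 * (x - m)\<^sup>2) gmax c x g"
  shows "x - g * \<alpha> * deriv (\<lambda>x. L / 2 * (x - m)\<^sup>2) x
    = (1 - 2 * (1 - c) * \<alpha>) * x + 2 * (1 - c) * \<alpha> * m"
proof (cases "x = m")
  case True
  then show ?thesis
    unfolding deriv_quadratic by (simp add: algebra_simps)
next
  case False
  then have "g = 2 * (1 - c) / L"
    using sls_step_quadratic assms by blast
  then have "g * \<alpha> * (L * (x - m)) = 2 * (1 - c) * \<alpha> * (x - m)"
    using \<open>0 < L\<close> by simp
  then show ?thesis
    unfolding deriv_quadratic by (simp add: algebra_simps)
qed

lemma f1_quadratic: "f1 = (\<lambda>x. 1 / 2 * (x - 1)\<^sup>2)"
  by (simp add: fun_eq_iff f1_def)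

lemma f2_quadratic: "f2 = (\<lambda>x. 4 / 2 * (x - (- 1 / 4))\<^sup>2)"
  by (simp add: fun_eq_iff f2_def power2_eq_square field_simps)

lemma arg_min_objective:
  assumes "is_arg_min objective (\<lambda>_. True) x"
  shows "x = 0"
proof -
  have "objective x = objective 0 + 5 / 4 * x\<^sup>2"
    by (simp add: objective_def f1_def f2_def power2_eq_square field_simps)
  moreover have "objective x \<le> objective 0"
    using assms by (simp add: is_arg_min_linorder)
  ultimately have "x\<^sup>2 \<le> 0"
    by simp
  then show ?thesis
    by simp
qed

lemma sls_update_component:
  assumes "1 \<le> gmax" and "1 / 2 \<le> c" and "c < 1"
    and step: "sls_step (component j) gmax c x g"
  shows "x - g * \<alpha> * deriv (component j) x
    = (1 - 2 * (1 - c) * \<alpha>) * x + 2 * (1 - c) * \<alpha> * (if j = 1 then 1 else - 1 / 4)"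
proof (cases "j = 1")
  case True
  then have f: "component j = (\<lambda>x. 1 / 2 * (x - 1)\<^sup>2)"
    by (simp add: component_def f1_quadratic)
  show ?thesis
    using sls_update_quadratic[of 1 c gmax 1 x g \<alpha>] assms True unfolding f by simp
next
  case False
  then have f: "component j = (\<lambda>x. 4 / 2 * (x - (- 1 / 4))\<^sup>2)"
    by (simp add: component_def f2_quadratic)
  have "2 * (1 - c) / 4 \<le> gmax"
    using assms by simp
  then show ?thesis
    using sls_update_quadratic[of 4 c gmax "- 1 / 4" x g \<alpha>] assms(3) step False
    unfolding f by simp
qed

lemma (in prob_space) has_bochner_integral_uniform_two_point:
  fixes u v :: real and X :: "'a \<Rightarrow> nat"
  assumes X: "X \<in> M \<rightarrow>\<^sub>M count_space {1, 2}"
    and unif: "distr M (count_space {1, 2}) X = uniform_count_measure {1, 2}"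
  shows "has_bochner_integral M (\<lambda>\<omega>. if X \<omega> = 1 then u else v) ((u + v) / 2)"
proof -
  define A where "A = X -` {1} \<inter> space M"
  have A: "A \<in> events"
    unfolding A_def using X by (rule measurable_sets) simp
  have "prob A = measure (distr M (count_space {1, 2}) X) {1}"
    unfolding A_def using X by (subst measure_distr) auto
  also have "\<dots> = 1 / 2"
    unfolding unif by (subst measure_uniform_count_measure) auto
  finally have "prob A = 1 / 2" .
  then have "v + (u - v) * prob A = (u + v) / 2"
    by (simp add: field_simps)
  moreover have "has_bochner_integral M (\<lambda>\<omega>. v + (u - v) * indicator A \<omega>) (v + (u - v) * prob A)"
    using A by (intro has_bochner_integral_add has_bochner_integral_mult_right
        has_bochner_integral_real_indicator)
      (auto simp: has_bochner_integral_iff prob_space emeasure_eq_measure)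
  ultimately have "has_bochner_integral M (\<lambda>\<omega>. v + (u - v) * indicator A \<omega>) ((u + v) / 2)"
    by (simp only:)
  moreover have "v + (u - v) * indicator A \<omega> = (if X \<omega> = 1 then u else v)" if "\<omega> \<in> space M" for \<omega>
    using that by (simp add: A_def indicator_def)
  ultimately show ?thesis
    by (simp cong: has_bochner_integral_cong)
qed

text \<open>The update is the sum of a fixed multiple of \<open>w k\<close> and a fixed multiple of the random
  minimizer, so the next mean follows by linearity.
  Integrability has to be carried along, since otherwise the expectation could be a default value.\<close>

lemma sgd_sls_run_mean:
  assumes gmax: "1 \<le> gmax" and c: "1 / 2 \<le> c" "c < 1"
    and \<alpha>: "\<forall>k\<in>{1..T}. 0 \<le> \<alpha> k \<and> \<alpha> k \<le> 1"
    and run: "sgd_sls_run M T gmax c \<alpha> w1 i \<gamma> w"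
    and "1 \<le> k" and "k \<le> T"
  shows "\<exists>\<mu>. has_bochner_integral M (w k) \<mu> \<and> min w1 (3 / 8) \<le> \<mu>"
  using \<open>1 \<le> k\<close> \<open>k \<le> T\<close>
proof (induction k rule: dec_induct)
  case base
  interpret prob_space M
    using run by (simp add: sgd_sls_run_def)
  have "has_bochner_integral M (\<lambda>_. w1) w1"
    by (simp add: has_bochner_integral_iff prob_space)
  moreover have "w 1 \<omega> = w1" if "\<omega> \<in> space M" for \<omega>
    using run that by (simp add: sgd_sls_run_def)
  ultimately have "has_bochner_integral M (w 1) w1"
    by (simp cong: has_bochner_integral_cong)
  then show ?case
    by (intro exI[of _ w1]) simp
next
  case (step k)
  interpret prob_space M
    using run by (simp add: sgd_sls_run_def)
  have k: "k \<in> {1..T}"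
    using step by simp
  obtain \<mu> where \<mu>: "has_bochner_integral M (w k) \<mu>" "min w1 (3 / 8) \<le> \<mu>"
    using step by auto
  define a where "a = 2 * (1 - c) * \<alpha> k"
  have a: "0 \<le> a" "a \<le> 1"
    using \<alpha> c k mult_mono[of "2 * (1 - c)" 1 "\<alpha> k" 1] by (auto simp: a_def)
  have X: "i k \<in> M \<rightarrow>\<^sub>M count_space {1, 2}"
    using run k by (auto simp: sgd_sls_run_def indep_vars_def)
  have unif: "distr M (count_space {1, 2}) (i k) = uniform_count_measure {1, 2}"
    using run k by (auto simp: sgd_sls_run_def)
  have "has_bochner_integral M (\<lambda>\<omega>. if i k \<omega> = 1 then 1 else - 1 / 4) (3 / 8 :: real)"
    using has_bochner_integral_uniform_two_point[OF X unif, of 1 "- 1 / 4"] by simp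
  then have "has_bochner_integral M
      (\<lambda>\<omega>. (1 - a) * w k \<omega> + a * (if i k \<omega> = 1 then 1 else - 1 / 4)) ((1 - a) * \<mu> + a * (3 / 8))"
    by (intro has_bochner_integral_add has_bochner_integral_mult_right \<mu>(1))
  moreover have "w (Suc k) \<omega> = (1 - a) * w k \<omega> + a * (if i k \<omega> = 1 then 1 else - 1 / 4)"
    if "\<omega> \<in> space M" for \<omega>
  proof -
    have "sls_step (component (i k \<omega>)) gmax c (w k \<omega>) (\<gamma> k \<omega>)"
      and "w (Suc k) \<omega> = w k \<omega> - \<gamma> k \<omega> * \<alpha> k * deriv (component (i k \<omega>)) (w k \<omega>)"
      using run k that by (auto simp: sgd_sls_run_def)
    then show ?thesis
      using sls_update_component[OF gmax c] by (simp add: a_def)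
  qed
  ultimately have "has_bochner_integral M (w (Suc k)) ((1 - a) * \<mu> + a * (3 / 8))"
    by (simp cong: has_bochner_integral_cong)
  moreover have "min w1 (3 / 8) \<le> (1 - a) * \<mu> + a * (3 / 8)"
  proof -
    have "(1 - a) * min w1 (3 / 8) + a * min w1 (3 / 8) \<le> (1 - a) * \<mu> + a * (3 / 8)"
      using a \<mu>(2) by (intro add_mono mult_left_mono) auto
    then show ?thesis
      by (simp add: algebra_simps)
  qed
  ultimately show ?case
    by blast
qed

theorem theorem3:
  fixes M :: "'a measure" and T :: nat and gmax c w1 wstar :: real
    and \<alpha> :: "nat \<Rightarrow> real" and i :: "nat \<Rightarrow> 'a \<Rightarrow> nat" and \<gamma> w :: "nat \<Rightarrow> 'a \<Rightarrow> real"
  assumes "1 \<le> T"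
    and "1 \<le> gmax"
    and "1/2 \<le> c" and "c < 1"
    and "convergent \<alpha>"
    and "\<forall>k\<in>{1..T}. 0 \<le> \<alpha> k \<and> \<alpha> k \<le> 1"
    and "sgd_sls_run M T gmax c \<alpha> w1 i \<gamma> w"
    and "is_arg_min objective (\<lambda>_. True) wstar"
    and "0 < w1"
  shows "prob_space.expectation M (\<lambda>\<omega>. w T \<omega> - wstar) \<ge> min w1 (3/8)"
proof -
  have "wstar = 0"
    using assms(8) by (rule arg_min_objective)
  moreover obtain \<mu> where "has_bochner_integral M (w T) \<mu>" "min w1 (3 / 8) \<le> \<mu>"
    using sgd_sls_run_mean[OF assms(2-4,6,7,1) order_refl] by blast
  ultimately show ?thesis
    by (simp add: has_bochner_integral_integral_eq)
qed

end
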